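(* Let $\alpha'$ be the root of $(1-\alpha')\cdot(\ln(1-\alpha')+2)-1=0$ satisfying $\alpha'>0.357$. Let $S_{\mathrm m}$ be the output of MGreedy, $S_0=\emptyset\subseteq S_1\subseteq\dots$ the successive greedy sets, and $\Lambda:=\min_{0\le i\le |S_{\mathrm g}|}\{f(S_i)+\Delta(b\mid S_i)\}$. Then $$f(\mathrm{OPT})\le \Lambda\le \frac{f(S_{\mathrm m})}{\alpha'}\le \frac{f(\mathrm{OPT})}{\alpha'}.$$
   Context: Problem: $V$ is a finite ground set; $f:2^V\to\mathbb{R}$ is monotone nondecreasing, submodular, and $f(\emptyset)=0$. Each element $v$ has a cost $c(v)>0$, $c(S)=\sum_{v\in S}c(v)$, and the budget $b$ satisfies $c(v)\le b$ for all $v$. The problem is $\max f(S)$ subject to $c(S)\le b$, with optimal solution $\mathrm{OPT}$. Write $f(v\mid S)=f(S\cup\{v\})-f(S)$. MGreedy: set $S_{\mathrm g}\gets\emptyset$, $V'\gets V$. While $V'\neq\emptyset$: pick $u\in V'$ maximizing $f(u\mid S_{\mathrm g})/c(u)$ (ties arbitrary); if $c(S_{\mathrm g})+c(u)\le b$ add $u$ to $S_{\mathrm g}$; remove $u$ from $V'$. Then let $v^*\in\arg\max_v f(\{v\})$ and output $S_{\mathrm m}$, whichever of $\{v^*\},S_{\mathrm g}$ has the larger $f$-value. Let $u_i$ be the $i$-th element added to $S_{\mathrm g}$, and $S_i=\{u_1,\dots,u_i\}$. For $S\subseteq V$, $\Delta(b\mid S)$ is the optimum of the fractional knapsack LP $\max\sum_{v\in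 V\setminus S} f(v\mid S)x_v$ s.t. $\sum_{v\in V\setminus S}c(v)x_v\le b$, $0\le x_v\le 1$. Equivalently, sort $V\setminus S$ as $v_1,v_2,\dots$ in descending order of $f(v\mid S)/c(v)$. Let $r$ be the least index with $\sum_{i\le r}c(v_i)>b$ and $c^*=\sum_{i<r}c(v_i)$. Then $\Delta(b\mid S)=\sum_{i<r}f(v_i\mid S)+f(v_r\mid S)(b-c^* )/c(v_r)$. *)

theory Defs
  imports Complex_Main
begin

definition submodular_on :: "'a set \<Rightarrow> ('a set \<Rightarrow> real) \<Rightarrow> bool" where
  "submodular_on V f \<longleftrightarrow>
     (\<forall>A B. A \<subseteq> V \<longrightarrow> B \<subseteq> V \<longrightarrow> f (A \<union> B) + f (A \<inter> B) \<le> f A + f B)"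

definition marginal :: "('a set \<Rightarrow> real) \<Rightarrow> 'a \<Rightarrow> 'a set \<Rightarrow> real" where
  "marginal f v S = f (S \<union> {v}) - f S"

text \<open>The feasible region is nonempty and compact when \<open>V\<close> is finite, \<open>b \<ge> 0\<close> and the costs
  are positive, so the supremum below is the attained optimum of the fractional knapsack LP.\<close>

definition frac_knapsack ::
    "'a set \<Rightarrow> ('a set \<Rightarrow> real) \<Rightarrow> ('a \<Rightarrow> real) \<Rightarrow> real \<Rightarrow> 'a set \<Rightarrow> real" where
  "frac_knapsack V f c b S =
     Sup {(\<Sum>v\<in>V - S. marginal f v S * x v) | x.
            (\<Sum>v\<in>V - S. c v * x v) \<le> b \<and> (\<forall>v\<in>V - S. 0 \<le> x v \<and> x v \<le> 1)}"

text \<open>\<open>greedy_state V f c b us R\<close>: the greedy loop can reach a state in which the elements added so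
  far are \<open>us\<close>, in order of addition, and \<open>R\<close> is the set of elements still to be considered.
  A relation is used because ties are broken arbitrarily.\<close>

inductive greedy_state ::
    "'a set \<Rightarrow> ('a set \<Rightarrow> real) \<Rightarrow> ('a \<Rightarrow> real) \<Rightarrow> real \<Rightarrow> 'a list \<Rightarrow> 'a set \<Rightarrow> bool"
  for V f c b where
  init: "greedy_state V f c b [] V"
| accept: "greedy_state V f c b us R \<Longrightarrow>
     is_arg_max (\<lambda>v. marginal f v (set us) / c v) (\<lambda>v. v \<in> R) u \<Longrightarrow>
     sum c (set us) + c u \<le> b \<Longrightarrow> greedy_state V f c b (us @ [u]) (R - {u})"
| reject: "greedy_state V f c b us R \<Longrightarrow>
     is_arg_max (\<lambda>v. marginal f v (set us) / c v) (\<lambda>v. v \<in> R) u \<Longrightarrow>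
     \<not> sum c (set us) + c u \<le> b \<Longrightarrow> greedy_state V f c b us (R - {u})"

text \<open>\<open>mgreedy V f c b us Sm\<close>: some complete run of MGreedy adds exactly the elements \<open>us\<close>, in this
  order, and outputs \<open>Sm\<close>.  The best singleton exists only if \<open>V\<close> is nonempty, so there is no run
  on an empty ground set.\<close>

definition mgreedy ::
    "'a set \<Rightarrow> ('a set \<Rightarrow> real) \<Rightarrow> ('a \<Rightarrow> real) \<Rightarrow> real \<Rightarrow> 'a list \<Rightarrow> 'a set \<Rightarrow> bool" where
  "mgreedy V f c b us Sm \<longleftrightarrow>
     greedy_state V f c b us {} \<and>
     (\<exists>v. is_arg_max (\<lambda>v. f {v}) (\<lambda>v. v \<in> V) v \<and>
          is_arg_max f (\<lambda>T. T \<in> {{v}, set us}) Sm)"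

definition greedy_prefix :: "'a list \<Rightarrow> nat \<Rightarrow> 'a set" where
  "greedy_prefix us i = set (take i us)"

definition upper_bound ::
    "'a set \<Rightarrow> ('a set \<Rightarrow> real) \<Rightarrow> ('a \<Rightarrow> real) \<Rightarrow> real \<Rightarrow> 'a list \<Rightarrow> real" where
  "upper_bound V f c b us =
     Min ((\<lambda>i. f (greedy_prefix us i) + frac_knapsack V f c b (greedy_prefix us i))
            ` {0..card (set us)})"

text \<open>The constant is well defined.  The condition \<open>\<alpha> < 1\<close> is the domain of
  \<open>ln (1 - \<alpha>)\<close>, which is needed because \<open>ln\<close> is a total function here.\<close>

lemma alpha_root_unique:
  "\<exists>!\<alpha>::real. (1 - \<alpha>) * (ln (1 - \<alpha>) + 2) - 1 = 0 \<and> 0.357 < \<alpha> \<and> \<alpha> < 1"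
proof -
  let ?g = "\<lambda>x::real. x * (ln x + 2) - 1"
  have der: "(?g has_real_derivative (ln x + 3)) (at x)" if "x > 0" for x
    using that by (auto intro!: derivative_eq_intros)
  have incr: "?g x < ?g y" if "exp (-3) < x" "x < y" for x y
  proof (rule DERIV_pos_imp_increasing[OF that(2)])
    fix z assume z: "x \<le> z" "z \<le> y"
    have p: "exp (-3) < z" using that z by linarith
    have p0: "0 < z" using p exp_gt_zero[of "-3::real"] by linarith
    have "-3 < ln z" using p p0 by (metis ln_exp ln_less_cancel_iff exp_gt_zero)
    then show "\<exists>d. DERIV ?g z :> d \<and> d > 0" using der[OF p0] by (intro exI[of _ "ln z + 3"]) auto
  qed
  have neg: "?g x < 0" if "0 < x" "x \<le> exp (-3)" for x
  proof -
    have "ln x \<le> -3" using that by (metis ln_exp ln_le_cancel_iff exp_gt_zero)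
    then have "x * (ln x + 2) \<le> 0" using that by (intro mult_nonneg_nonpos) auto
    then show ?thesis by simp
  qed
  have lo: "?g (1/2) < 0"
    by (simp add: ln_div)
  have hi: "?g 0.643 > 0"
  proof -
    have "1 - 1 / (0.99312::real) \<le> ln 0.99312"
      using ln_le_minus_one[of "1 / 0.99312 :: real"] by (simp add: ln_div)
    then have "64 * (1 - 1 / (0.99312::real)) \<le> ln (0.99312 ^ 64)"
      by (simp only: ln_realpow) simp
    also have "\<dots> \<le> ln 0.643"
      by (subst ln_le_cancel_iff) (simp_all add: power_divide)
    finally show ?thesis by simp
  qed
  have "\<exists>x\<ge>1/2. x \<le> 0.643 \<and> ?g x = 0"
    by (rule IVT') (use lo hi in \<open>auto intro!: continuous_intros\<close>)
  then obtain x where x: "1/2 \<le> x" "x \<le> 0.643" "?g x = 0" by blast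
  have "x \<noteq> 0.643" using hi x(3) by (metis less_irrefl)
  with x have ex: "(1 - (1 - x)) * (ln (1 - (1 - x)) + 2) - 1 = 0 \<and> 0.357 < 1 - x \<and> 1 - x < 1"
    by auto
  show ?thesis
  proof (rule ex1I[where a = "1 - x"])
    show "(1 - (1 - x)) * (ln (1 - (1 - x)) + 2) - 1 = 0 \<and> 0.357 < 1 - x \<and> 1 - x < 1"
      by (rule ex)
  next
    fix a :: real
    assume a: "(1 - a) * (ln (1 - a) + 2) - 1 = 0 \<and> 0.357 < a \<and> a < 1"
    have "exp (-3) < 1 - a" using neg[of "1 - a"] a by force
    moreover have "exp (-3) < x" using neg[of x] x by force
    ultimately show "a = 1 - x"
      using incr[of "1 - a" x] incr[of x "1 - a"] a x(3) by (cases "1 - a" x rule: linorder_cases) auto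
  qed
qed

end

theory Submission
  imports Defs
begin

text \<open>
  Compare the greedy sets \<open>S\<close> up to the first rejected element \<open>w\<close>.  Until then the best available
  density bounds the whole fractional knapsack, so each acceptance of \<open>u\<close> shrinks \<open>\<Lambda> - f S\<close> by the
  factor \<open>1 - c u / b\<close>, whence \<open>f S \<ge> (1 - exp (- c S / b)) * \<Lambda>\<close> for the set \<open>S\<close> rejecting \<open>w\<close>.
  Put \<open>\<beta> = - ln (1 - \<alpha>)\<close>.  If \<open>c S / b \<ge> \<beta>\<close>, this is already at least \<open>\<alpha> * \<Lambda>\<close>.  Otherwise \<open>w\<close> is
  expensive, \<open>c w > (1 - \<beta>) * b\<close>, so its density is small and
  \<open>\<Lambda> \<le> f S + b * f(w | S) / c w \<le> f Sm * (1 + 1 / (1 - \<beta>))\<close>; the equation for \<open>\<alpha>\<close> says that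
  this factor is exactly \<open>1 / \<alpha>\<close>.  If nothing is rejected, the greedy set is \<open>V\<close>.
\<close>

locale submodular_knapsack =
  fixes V :: "'a set" and f :: "'a set \<Rightarrow> real" and c :: "'a \<Rightarrow> real" and b :: real
  assumes finite_V: "finite V"
    and mono: "mono_on (Pow V) f"
    and submodular: "submodular_on V f"
    and f_empty: "f {} = 0"
    and cost_pos: "\<And>v. v \<in> V \<Longrightarrow> 0 < c v"
    and cost_le: "\<And>v. v \<in> V \<Longrightarrow> c v \<le> b"
    and budget_pos: "0 < b"
begin

section \<open>Marginals of a monotone submodular function\<close>

lemma f_mono: "S \<subseteq> T \<Longrightarrow> T \<subseteq> V \<Longrightarrow> f S \<le> f T"
  using mono by (auto simp: mono_on_def)

lemma f_nonneg: "S \<subseteq> V \<Longrightarrow> 0 \<le> f S"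
  using f_mono[of "{}" S] f_empty by simp

lemma f_union_inter_le: "S \<subseteq> V \<Longrightarrow> T \<subseteq> V \<Longrightarrow> f (S \<union> T) + f (S \<inter> T) \<le> f S + f T"
  using submodular by (auto simp: submodular_on_def)

lemma marginal_nonneg: "S \<subseteq> V \<Longrightarrow> v \<in> V \<Longrightarrow> 0 \<le> marginal f v S"
  using f_mono[of S "S \<union> {v}"] by (auto simp: marginal_def)

lemma marginal_antimono:
  assumes "S \<subseteq> T" "T \<subseteq> V" "v \<in> V - T"
  shows "marginal f v T \<le> marginal f v S"
proof -
  have "(S \<union> {v}) \<union> T = T \<union> {v}" "(S \<union> {v}) \<inter> T = S" using assms by auto
  moreover have "S \<subseteq> V" using assms by blast
  ultimately show ?thesis
    using f_union_inter_le[of "S \<union> {v}" T] assms by (simp add: marginal_def)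
qed

text \<open>Submodularity of \<open>f\<close> at \<open>S\<close> and \<open>{v}\<close>, with the
  nonnegative term \<open>f (S \<inter> {v})\<close> dropped; this also covers
  \<open>v \<in> S\<close>.\<close>

lemma marginal_le_singleton:
  assumes "S \<subseteq> V" "v \<in> V"
  shows "marginal f v S \<le> f {v}"
proof -
  have "0 \<le> f (S \<inter> {v})" using assms by (intro f_nonneg) auto
  then show ?thesis
    using f_union_inter_le[of S "{v}"] assms by (auto simp: marginal_def)
qed

text \<open>Add the elements of \<open>T\<close> one at a time: by diminishing returns each actual
  gain is at most the marginal with respect to \<open>S\<close>.\<close>

lemma f_union_le_sum_marginal:
  assumes "S \<subseteq> V" "T \<subseteq> V - S"
  shows "f (S \<union> T) \<le> f S + (\<Sum>v\<in>T. marginal f v S)"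
proof -
  have "finite T" using assms finite_V by (meson finite_Diff finite_subset)
  then show ?thesis using assms(2)
  proof (induction T)
    case (insert v T)
    have "marginal f v (S \<union> T) \<le> marginal f v S"
      using insert assms(1) by (intro marginal_antimono) auto
    with insert show ?case by (simp add: marginal_def)
  qed simp
qed

section \<open>Bounds on the fractional knapsack optimum\<close>

lemma le_frac_knapsack:
  assumes "S \<subseteq> V" "(\<Sum>v\<in>V - S. c v * x v) \<le> b" "\<And>v. v \<in> V - S \<Longrightarrow> 0 \<le> x v \<and> x v \<le> 1"
  shows "(\<Sum>v\<in>V - S. marginal f v S * x v) \<le> frac_knapsack V f c b S"
  unfolding frac_knapsack_def
proof (rule cSup_upper)
  show "bdd_above {\<Sum>v\<in>V - S. marginal f v S * x v |x.
      (\<Sum>v\<in>V - S. c v * x v) \<le> b \<and> (\<forall>v\<in>V - S. 0 \<le> x v \<and> x v \<le> 1)}"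
    \<comment> \<open>Marginals are nonnegative, so taking every item fully bounds all LP values,
      even if it exceeds the budget.\<close>
    by (rule bdd_aboveI[of _ "\<Sum>v\<in>V - S. marginal f v S"])
       (auto intro!: sum_mono mult_left_le marginal_nonneg assms(1))
qed (use assms in auto)

lemma frac_knapsack_le:
  assumes "\<And>x. (\<Sum>v\<in>V - S. c v * x v) \<le> b \<Longrightarrow> (\<And>v. v \<in> V - S \<Longrightarrow> 0 \<le> x v \<and> x v \<le> 1) \<Longrightarrow>
      (\<Sum>v\<in>V - S. marginal f v S * x v) \<le> B"
  shows "frac_knapsack V f c b S \<le> B"
  unfolding frac_knapsack_def
proof (rule cSup_least)
  show "{\<Sum>v\<in>V - S. marginal f v S * x v |x.
      (\<Sum>v\<in>V - S. c v * x v) \<le> b \<and> (\<forall>v\<in>V - S. 0 \<le> x v \<and> x v \<le> 1)} \<noteq> {}"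
    using budget_pos by (auto intro!: exI[of _ "\<lambda>_. 0"])
qed (use assms in auto)

text \<open>Each unit of budget earns at most the best density, and only \<open>b\<close> units can
  be spent.\<close>

lemma frac_knapsack_le_density:
  assumes "S \<subseteq> V" "is_arg_max (\<lambda>v. marginal f v S / c v) (\<lambda>v. v \<in> V - S) u"
  shows "frac_knapsack V f c b S \<le> b * (marginal f u S / c u)"
proof (rule frac_knapsack_le)
  let ?\<rho> = "marginal f u S / c u"
  have u: "u \<in> V - S" and max: "\<And>v. v \<in> V - S \<Longrightarrow> marginal f v S / c v \<le> ?\<rho>"
    using assms(2) by (auto simp: is_arg_max_linorder)
  \<comment> \<open>A fractional solution may leave budget unspent; rounding its cost up to
    \<open>b\<close> requires a nonnegative density.\<close>
  have \<rho>: "0 \<le> ?\<rho>" using u assms(1) cost_pos[of u] marginal_nonneg[of S u] by simp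
  fix x assume x: "(\<Sum>v\<in>V - S. c v * x v) \<le> b" "\<And>v. v \<in> V - S \<Longrightarrow> 0 \<le> x v \<and> x v \<le> 1"
  have "(\<Sum>v\<in>V - S. marginal f v S * x v) \<le> (\<Sum>v\<in>V - S. ?\<rho> * (c v * x v))"
  proof (rule sum_mono)
    fix v assume v: "v \<in> V - S"
    then have "marginal f v S \<le> ?\<rho> * c v"
      using max[OF v] cost_pos[of v] by (simp add: pos_divide_le_eq)
    from mult_right_mono[OF this, of "x v"] show "marginal f v S * x v \<le> ?\<rho> * (c v * x v)"
      using x(2)[OF v] by (simp only: mult.assoc)
  qed
  also have "\<dots> \<le> ?\<rho> * b"
    unfolding sum_distrib_left[symmetric] by (rule mult_left_mono[OF x(1) \<rho>])
  finally show "(\<Sum>v\<in>V - S. marginal f v S * x v) \<le> b * ?\<rho>" by (simp only: mult.commute)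
qed

text \<open>The indicator of \<open>T - S\<close> is a feasible LP point, and its value bounds the
  gain from \<open>S\<close> to \<open>S \<union> T\<close>.\<close>

lemma feasible_le_frac_knapsack:
  assumes "S \<subseteq> V" "T \<subseteq> V" "sum c T \<le> b"
  shows "f T \<le> f S + frac_knapsack V f c b S"
proof -
  have fin: "finite (V - S)" and sub: "(V - S) \<inter> T = T - S" using finite_V assms by auto
  have ind: "(\<Sum>v\<in>V - S. g v * of_bool (v \<in> T)) = (\<Sum>v\<in>T - S. g v)" for g :: "'a \<Rightarrow> real"
  proof -
    have "(\<Sum>v\<in>V - S. g v * of_bool (v \<in> T)) = (\<Sum>v\<in>V - S. if v \<in> T then g v else 0)"
      by (intro sum.cong) auto
    also have "\<dots> = (\<Sum>v\<in>T - S. g v)" using sum.inter_restrict[OF fin, of g T] sub by simp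
    finally show ?thesis .
  qed
  have "sum c (T - S) \<le> sum c T"
    using assms finite_V cost_pos
    by (intro sum_mono2) (auto intro: finite_subset less_imp_le)
  with assms have "(\<Sum>v\<in>T - S. marginal f v S) \<le> frac_knapsack V f c b S"
    using le_frac_knapsack[of S "\<lambda>v. of_bool (v \<in> T)"] by (simp add: ind)
  moreover have "f T \<le> f (S \<union> (T - S))" using assms by (intro f_mono) auto
  moreover have "\<dots> \<le> f S + (\<Sum>v\<in>T - S. marginal f v S)"
    using assms by (intro f_union_le_sum_marginal) auto
  ultimately show ?thesis by linarith
qed

section \<open>Greedy runs up to the first rejection\<close>

lemma greedy_state_basic:
  assumes "greedy_state V f c b us R"
  shows "distinct us \<and> set us \<subseteq> V \<and> R \<subseteq> V - set us \<and> sum c (set us) \<le> b"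
  using assms
proof induction
  case (accept us R u)
  then show ?case by (auto simp: is_arg_max_def)
qed (use budget_pos in auto)

text \<open>The assumed bound on \<open>L\<close> says that \<open>u\<close> closes at least the
  fraction \<open>c u / b\<close> of the gap \<open>L - f S\<close>. Since 1 - t \<le> exp (-t),
  these factors multiply to an exponential of the total cost.\<close>

lemma greedy_growth:
  assumes "u \<in> V - S" "finite S" "0 \<le> L" "L \<le> f S + b * (marginal f u S / c u)"
    and "L - f S \<le> exp (- sum c S / b) * L"
  shows "L - f (S \<union> {u}) \<le> exp (- sum c (S \<union> {u}) / b) * L"
proof -
  have c: "0 < c u" "c u \<le> b" using assms(1) cost_pos cost_le by auto
  have "(c u / b) * (L - f S) \<le> (c u / b) * (b * (marginal f u S / c u))"
    using c budget_pos assms(4) by (intro mult_left_mono) auto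
  also have "\<dots> = marginal f u S" using c budget_pos by simp
  finally have "L - f (S \<union> {u}) \<le> (1 - c u / b) * (L - f S)"
    by (simp add: marginal_def algebra_simps)
  \<comment> \<open>No element exceeds the budget, so the factor \<open>1 - c u / b\<close> is
    nonnegative.\<close>
  also have "\<dots> \<le> (1 - c u / b) * (exp (- sum c S / b) * L)"
    using c budget_pos assms(5) by (intro mult_left_mono) auto
  also have "\<dots> \<le> exp (- (c u / b)) * (exp (- sum c S / b) * L)"
    using exp_ge_add_one_self[of "- (c u / b)"] assms(3) by (intro mult_right_mono) auto
  also have "\<dots> = exp (- sum c (S \<union> {u}) / b) * L"
  proof -
    have "sum c (S \<union> {u}) = c u + sum c S" using assms(1,2) by simp
    then have "- (c u / b) + - sum c S / b = - sum c (S \<union> {u}) / b"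
      by (simp add: diff_divide_distrib)
    then show ?thesis by (metis mult.assoc mult_exp_exp)
  qed
  finally show ?thesis .
qed

text \<open>The equation \<open>set us \<union> R = V\<close> says that nothing has been rejected so
  far; then the greedy choice has the best density in all of \<open>V - set us\<close>, and the LP
  bound applies. The other alternative freezes the first rejection: \<open>S\<close> is the greedy
  set at that moment, so later acceptances only enlarge \<open>us\<close> beyond it. An arbitrary
  \<open>L\<close> replaces \<open>upper_bound\<close>, which depends on the final list and would
  change during the induction.\<close>

lemma greedy_state_dichotomy:
  assumes "greedy_state V f c b us R" "0 \<le> L"
    and "\<And>i. i \<le> length us \<Longrightarrow>
      L \<le> f (greedy_prefix us i) + frac_knapsack V f c b (greedy_prefix us i)"
  shows "(set us \<union> R = V \<and> L - f (set us) \<le> exp (- sum c (set us) / b) * L) \<or>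
    (\<exists>S w. S \<subseteq> set us \<and> w \<in> V \<and> b < sum c S + c w \<and>
       L \<le> f S + b * (marginal f w S / c w) \<and> L - f S \<le> exp (- sum c S / b) * L)"
  using assms(1,3)
proof induction
  case init
  show ?case by (simp add: f_empty)
next
  case (accept us R u)
  \<comment> \<open>Prefixes of \<open>us\<close> are also prefixes of
    \<open>us @ [u]\<close>.\<close>
  have "L \<le> f (greedy_prefix us i) + frac_knapsack V f c b (greedy_prefix us i)"
    if "i \<le> length us" for i
    using accept.prems[of i] that by (simp add: greedy_prefix_def)
  from accept.IH[OF this]
  consider (all) "set us \<union> R = V" "L - f (set us) \<le> exp (- sum c (set us) / b) * L"
    | (rej) "\<exists>S w. S \<subseteq> set us \<and> w \<in> V \<and> b < sum c S + c w \<and>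
       L \<le> f S + b * (marginal f w S / c w) \<and> L - f S \<le> exp (- sum c S / b) * L"
    by blast
  then show ?case
  proof cases
    case all
    note basic = greedy_state_basic[OF accept.hyps(1)]
    have R: "R = V - set us" using basic all(1) by blast
    have u: "u \<in> R" using accept.hyps(2) by (simp add: is_arg_max_def)
    have "frac_knapsack V f c b (set us) \<le> b * (marginal f u (set us) / c u)"
      using frac_knapsack_le_density basic accept.hyps(2) R by simp
    then have "L \<le> f (set us) + b * (marginal f u (set us) / c u)"
      using accept.prems[of "length us"] by (simp add: greedy_prefix_def)
    then have "L - f (set us \<union> {u}) \<le> exp (- sum c (set us \<union> {u}) / b) * L"
      using u R assms(2) all(2) by (intro greedy_growth) auto
    with all(1) u show ?thesis by auto
  next
    case rej
    moreover have "set us \<subseteq> set (us @ [u])" by auto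
    ultimately show ?thesis by (meson order_trans)
  qed
next
  case (reject us R u)
  from reject.IH[OF reject.prems]
  consider (all) "set us \<union> R = V" "L - f (set us) \<le> exp (- sum c (set us) / b) * L"
    | (rej) "\<exists>S w. S \<subseteq> set us \<and> w \<in> V \<and> b < sum c S + c w \<and>
       L \<le> f S + b * (marginal f w S / c w) \<and> L - f S \<le> exp (- sum c S / b) * L"
    by blast
  then show ?case
  proof cases
    case all
    note basic = greedy_state_basic[OF reject.hyps(1)]
    have R: "R = V - set us" using basic all(1) by blast
    have u: "u \<in> V" using reject.hyps(2) R by (simp add: is_arg_max_def)
    have "frac_knapsack V f c b (set us) \<le> b * (marginal f u (set us) / c u)"
      using frac_knapsack_le_density basic reject.hyps(2) R by simp
    then have "L \<le> f (set us) + b * (marginal f u (set us) / c u)"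
      using reject.prems[of "length us"] by (simp add: greedy_prefix_def)
    with all(2) u reject.hyps(3) show ?thesis by (intro disjI2 exI[of _ "set us"] exI[of _ u]) auto
  next
    case rej
    then show ?thesis by blast
  qed
qed

text \<open>\<open>M\<close> stands for the value of the output, which dominates both the greedy set
  and every singleton.\<close>

lemma first_rejection_bound:
  assumes S: "S \<subseteq> V" "w \<in> V" "b < sum c S + c w"
    and L: "0 \<le> L" "L \<le> f S + b * (marginal f w S / c w)" "L - f S \<le> exp (- sum c S / b) * L"
    and M: "f S \<le> M" "f {w} \<le> M"
    and \<alpha>: "(1 - \<alpha>) * (ln (1 - \<alpha>) + 2) - 1 = 0" "0 < \<alpha>" "\<alpha> < 1"
  shows "L \<le> M / \<alpha>"
proof -
  define s where "s = sum c S / b"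
  define \<beta> where "\<beta> = - ln (1 - \<alpha>)"
  have exp_\<beta>: "exp (- \<beta>) = 1 - \<alpha>" using \<alpha> by (simp add: \<beta>_def)
  have \<beta>: "(1 - \<alpha>) * (2 - \<beta>) = 1" using \<alpha>(1) by (simp add: \<beta>_def add.commute)
  then have \<alpha>_eq: "\<alpha> * (2 - \<beta>) = 1 - \<beta>" by (simp add: algebra_simps)
  have "0 < 2 - \<beta>" using \<beta> \<alpha>(3) zero_less_mult_pos[of "1 - \<alpha>" "2 - \<beta>"] by simp
  \<comment> \<open>This makes \<open>(1 - \<beta>) * b\<close> a positive lower bound for the cost
    of \<open>w\<close> below.\<close>
  then have \<beta>1: "0 < 1 - \<beta>" using \<alpha>_eq \<alpha>(2) mult_pos_pos[of \<alpha> "2 - \<beta>"] by linarith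
  have M0: "0 \<le> M" using f_nonneg[OF S(1)] M(1) by linarith
  show ?thesis
  proof (cases "\<beta> \<le> s")
    case True
    then have "exp (- s) * L \<le> exp (- \<beta>) * L" using L(1) by (intro mult_right_mono) auto
    with L(3) have "L - f S \<le> (1 - \<alpha>) * L" by (simp add: s_def exp_\<beta>)
    then have "L * \<alpha> \<le> M" using M(1) by (simp add: algebra_simps)
    then show ?thesis using \<alpha>(2) by (simp add: pos_le_divide_eq)
  next
    case False
    have "sum c S = s * b" using budget_pos by (simp add: s_def)
    also have "\<dots> \<le> \<beta> * b" using False budget_pos by (intro mult_right_mono) auto
    finally have cw: "(1 - \<beta>) * b \<le> c w" using S(3) by (simp add: algebra_simps)
    have "marginal f w S \<le> M" using marginal_le_singleton[OF S(1,2)] M(2) by linarith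
    then have "marginal f w S / c w \<le> M / ((1 - \<beta>) * b)"
      using M0 cw \<beta>1 budget_pos by (intro frac_le) auto
    from mult_left_mono[OF this, of b]
    have "b * (marginal f w S / c w) \<le> M / (1 - \<beta>)" using budget_pos by simp
    with L(2) M(1) have "L \<le> M + M / (1 - \<beta>)" by linarith
    also have "\<dots> = M * ((2 - \<beta>) / (1 - \<beta>))"
      using \<beta>1 by (simp add: add_divide_eq_iff algebra_simps)
    also have "(2 - \<beta>) / (1 - \<beta>) = 1 / \<alpha>" 
      using \<alpha>_eq \<alpha>(2) \<beta>1 by (simp add: frac_eq_eq mult.commute)
    finally show ?thesis by simp
  qed
qed

end

theorem theorem4p1:
  fixes V :: "'a set" and f :: "'a set \<Rightarrow> real" and c :: "'a \<Rightarrow> real" and b \<alpha> :: real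
    and OPT Sm :: "'a set" and us :: "'a list"
  assumes "finite V"
    and "mono_on (Pow V) f"
    and "submodular_on V f"
    and "f {} = 0"
    and "\<And>v. v \<in> V \<Longrightarrow> 0 < c v"
    and "\<And>v. v \<in> V \<Longrightarrow> c v \<le> b"
    and "is_arg_max f (\<lambda>T. T \<subseteq> V \<and> sum c T \<le> b) OPT"
    and "mgreedy V f c b us Sm"
    and "(1 - \<alpha>) * (ln (1 - \<alpha>) + 2) - 1 = 0" and "0.357 < \<alpha>" and "\<alpha> < 1"
  shows "f OPT \<le> upper_bound V f c b us
       \<and> upper_bound V f c b us \<le> f Sm / \<alpha>
       \<and> f Sm / \<alpha> \<le> f OPT / \<alpha>"
proof -
  obtain v where v: "is_arg_max (\<lambda>v. f {v}) (\<lambda>v. v \<in> V) v"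
    and Sm: "is_arg_max f (\<lambda>T. T \<in> {{v}, set us}) Sm" and run: "greedy_state V f c b us {}"
    using assms(8) by (auto simp: mgreedy_def)
  have vV: "v \<in> V" and vmax: "\<And>w. w \<in> V \<Longrightarrow> f {w} \<le> f {v}"
    using v by (auto simp: is_arg_max_linorder)
  \<comment> \<open>The best singleton of the run witnesses that \<open>V\<close> is nonempty, which
    forces a positive budget.\<close>
  have "0 < b" using assms(5,6)[OF vV] by linarith
  with assms interpret submodular_knapsack V f c b by unfold_locales
  have us: "distinct us" "set us \<subseteq> V" "sum c (set us) \<le> b"
    using greedy_state_basic[OF run] by auto
  have opt: "OPT \<subseteq> V" "sum c OPT \<le> b" "\<And>T. T \<subseteq> V \<Longrightarrow> sum c T \<le> b \<Longrightarrow> f T \<le> f OPT"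
    using assms(7) by (auto simp: is_arg_max_linorder)
  have Sm_in: "Sm \<in> {{v}, set us}" and Sm_max: "f {v} \<le> f Sm" "f (set us) \<le> f Sm"
    using Sm by (auto simp: is_arg_max_linorder)
  let ?L = "upper_bound V f c b us"
  have prefix: "greedy_prefix us i \<subseteq> V" for i
    using us(2) set_take_subset[of i us] by (auto simp: greedy_prefix_def)
  \<comment> \<open>The minimum is attained at some prefix, and every prefix gives an upper bound on
    the optimum.\<close>
  have "?L \<in> (\<lambda>i. f (greedy_prefix us i) + frac_knapsack V f c b (greedy_prefix us i))
      ` {0..card (set us)}"
    unfolding upper_bound_def by (intro Min_in) auto
  then have OPT_le: "f OPT \<le> ?L"
    using feasible_le_frac_knapsack[OF prefix opt(1,2)] by auto
  have L_le: "?L \<le> f (greedy_prefix us i) + frac_knapsack V f c b (greedy_prefix us i)"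
    if "i \<le> length us" for i
    unfolding upper_bound_def using that us(1) by (intro Min_le) (auto simp: distinct_card)
  have L0: "0 \<le> ?L" using OPT_le f_nonneg[OF opt(1)] by linarith
  have \<alpha>0: "0 < \<alpha>" using assms(10) by simp
  have Sm0: "0 \<le> f Sm" using Sm_max(2) f_nonneg[OF us(2)] by linarith
  have "(set us \<union> {} = V \<and> ?L - f (set us) \<le> exp (- sum c (set us) / b) * ?L) \<or>
    (\<exists>S w. S \<subseteq> set us \<and> w \<in> V \<and> b < sum c S + c w \<and>
       ?L \<le> f S + b * (marginal f w S / c w) \<and> ?L - f S \<le> exp (- sum c S / b) * ?L)"
    by (rule greedy_state_dichotomy[OF run L0 L_le])
  then have L_Sm: "?L \<le> f Sm / \<alpha>"
  proof (elim disjE conjE exE)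
    assume "set us \<union> {} = V"
    \<comment> \<open>With all of \<open>V\<close> accepted, the LP for the final set has no items
      left.\<close>
    then have "frac_knapsack V f c b (set us) \<le> 0"
      by (intro frac_knapsack_le) simp
    then have "?L \<le> f Sm" using L_le[of "length us"] Sm_max(2) by (simp add: greedy_prefix_def)
    also have "\<dots> \<le> f Sm / \<alpha>"
      using Sm0 \<alpha>0 assms(11) by (simp add: pos_le_divide_eq mult_left_le)
    finally show ?thesis .
  next
    fix S w
    assume S: "S \<subseteq> set us" and w: "w \<in> V" "b < sum c S + c w"
      and L: "?L \<le> f S + b * (marginal f w S / c w)" "?L - f S \<le> exp (- sum c S / b) * ?L"
    have "f S \<le> f Sm" using f_mono[OF S us(2)] Sm_max(2) by linarith
    moreover have "f {w} \<le> f Sm" using vmax[OF w(1)] Sm_max(1) by linarith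
    ultimately show ?thesis
      using first_rejection_bound[OF _ w L0 L _ _ assms(9) \<alpha>0 assms(11)] S us(2) by blast
  qed
  have "Sm \<subseteq> V" "sum c Sm \<le> b" using Sm_in us vV assms(6) by auto
  then have "f Sm / \<alpha> \<le> f OPT / \<alpha>" using opt(3) \<alpha>0 by (intro divide_right_mono) auto
  with OPT_le L_Sm show ?thesis by blast
qed

end
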